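(* Let $A\in\mathbb{R}^{n\times n}$, $B\in\mathbb{R}^{n\times m}$, let $Q\in\mathbb{R}^{n\times n}$ be symmetric and $R\in\mathbb{R}^{m\times m}$ symmetric positive definite, and let $$\mathbb{H}=\begin{bmatrix} A & -BR^{-1}B'\\ Q & A'\end{bmatrix}.$$ If $\mu\neq 0$ is an eigenvalue of the bidirectional dynamics $$\begin{bmatrix} x^+\\ \lambda\end{bmatrix}=\mathbb{H}\begin{bmatrix} x\\ \lambda^+\end{bmatrix},$$ then $\frac1\mu$ is also an eigenvalue of these dynamics.
   Context: A prime denotes transpose; $x^+=x_{k+1}$, $x=x_k$, $\lambda^+=\lambda_{k+1}$, $\lambda=\lambda_k$. A (complex) number $\mu$ is called an eigenvalue of the bidirectional dynamics if there is a nonzero vector $(\delta x,\delta\lambda)\in\mathbb{C}^n\times\mathbb{C}^n$ such that $$\mathbb{H}\begin{pmatrix}\delta x\\ \mu\,\delta\lambda\end{pmatrix}=\begin{pmatrix}\mu\,\delta x\\ \delta\lambda\end{pmatrix}.$$ (This is not the usual eigenvalue of the matrix $\mathbb{H}$.) *)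

theory Defs
  imports "HOL-Analysis.Analysis"
begin

definition block_vector :: "'a ^ 'n \<Rightarrow> 'a ^ 'm \<Rightarrow> 'a ^ ('n + 'm)" where
  "block_vector u v = (\<chi> i. case i of Inl a \<Rightarrow> u $ a | Inr b \<Rightarrow> v $ b)"

text \<open>\<open>block_matrix P Q R S\<close> is the matrix with first block row \<open>P\<close>, \<open>Q\<close> and second
  block row \<open>R\<close>, \<open>S\<close>.\<close>

definition block_matrix ::
  "'a ^ 'c ^ 'r \<Rightarrow> 'a ^ 'd ^ 'r \<Rightarrow> 'a ^ 'c ^ 's \<Rightarrow> 'a ^ 'd ^ 's \<Rightarrow> 'a ^ ('c + 'd) ^ ('r + 's)" where
  "block_matrix P Q R S =
    (\<chi> i. case i of Inl a \<Rightarrow> block_vector (P $ a) (Q $ a)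
                  | Inr b \<Rightarrow> block_vector (R $ b) (S $ b))"

definition symmetric_matrix :: "'a ^ 'n ^ 'n \<Rightarrow> bool" where
  "symmetric_matrix M \<longleftrightarrow> transpose M = M"

definition positive_definite_matrix :: "real ^ 'n ^ 'n \<Rightarrow> bool" where
  "positive_definite_matrix M \<longleftrightarrow> (\<forall>v. v \<noteq> 0 \<longrightarrow> v \<bullet> (M *v v) > 0)"

text \<open>The coefficient matrix of the bidirectional dynamics, which maps
  \<open>(x\<^sub>k, \<lambda>\<^sub>k\<^sub>+\<^sub>1)\<close> to \<open>(x\<^sub>k\<^sub>+\<^sub>1, \<lambda>\<^sub>k)\<close>.\<close>

definition bidir_matrix ::
  "real ^ 'n ^ 'n \<Rightarrow> real ^ 'm ^ 'n \<Rightarrow> real ^ 'n ^ 'n \<Rightarrow> real ^ 'm ^ 'm \<Rightarrow> real ^ ('n + 'n) ^ ('n + 'n)" where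
  "bidir_matrix A B Q R =
    block_matrix A (- (B ** matrix_inv R ** transpose B))
                 Q (transpose A)"

text \<open>The factor \<open>\<mu>\<close> stands on the second component on the input side and on the first
  component on the output side, because the costate is propagated backwards; this is therefore
  not an ordinary eigenvalue of \<open>H\<close>.\<close>

definition bidir_eigenvalue :: "real ^ ('n::finite + 'n) ^ ('n + 'n) \<Rightarrow> complex \<Rightarrow> bool" where
  "bidir_eigenvalue H \<mu> \<longleftrightarrow>
    (\<exists>(dx :: complex ^ 'n) (dl :: complex ^ 'n). (dx, dl) \<noteq> (0, 0) \<and>
      map_matrix complex_of_real H *v block_vector dx (\<mu> *s dl) = block_vector (\<mu> *s dx) dl)"

end

theory Submission
  imports Defs
begin

text \<open>
  Write \<open>G = B R\<^sup>-\<^sup>1 B'\<close>, which is symmetric because \<open>R\<close> is symmetric and,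
  being positive definite, invertible.  A nonzero pair \<open>(x, l)\<close> satisfies the eigenvector equations
  for \<open>\<mu>\<close> exactly when it lies in the kernel of the pencil
  \<open>M(\<mu>) = [A - \<mu> I, -\<mu> G; Q, \<mu> A' - I]\<close>.  A square matrix over a field is singular precisely when
  its transpose is, so \<open>M(\<mu>)'\<close> annihilates some \<open>(u, v) \<noteq> 0\<close>; by the symmetry of \<open>Q\<close> and \<open>G\<close> this
  reads \<open>A' u + Q v = \<mu> u\<close> and \<open>\<mu> A v - \<mu> G u = v\<close>.
  Dividing the second equation by \<open>\<mu>\<close> shows that \<open>(v, \<mu> u)\<close> solves the eigenvector equations for
  \<open>1 / \<mu>\<close>.  So passing to the transpose exchanges the roles of state and costate, that is, it
  reverses time.
\<close>

lemma sum_UNIV_plus: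
  fixes f :: "'n::finite + 'm::finite \<Rightarrow> 'a::comm_monoid_add"
  shows "sum f UNIV = (\<Sum>a\<in>UNIV. f (Inl a)) + (\<Sum>b\<in>UNIV. f (Inr b))"
  by (simp flip: UNIV_Plus_UNIV add: sum.Plus comp_def)

lemma block_vector_eq_iff: "block_vector u v = block_vector u' v' \<longleftrightarrow> u = u' \<and> v = v'"
proof
  assume eq: "block_vector u v = block_vector u' v'"
  have "u $ a = u' $ a" for a
    using arg_cong[OF eq, of "\<lambda>w. w $ Inl a"] by (simp add: block_vector_def)
  moreover have "v $ b = v' $ b" for b
    using arg_cong[OF eq, of "\<lambda>w. w $ Inr b"] by (simp add: block_vector_def)
  ultimately show "u = u' \<and> v = v'" by (simp add: vec_eq_iff)
qed simp

lemma block_vector_0: "block_vector 0 0 = 0"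
  by (simp add: block_vector_def vec_eq_iff split: sum.split)

lemma block_vector_surj: obtains u v where "w = block_vector u v"
proof
  show "w = block_vector (\<chi> a. w $ Inl a) (\<chi> b. w $ Inr b)"
    by (simp add: block_vector_def vec_eq_iff split: sum.split)
qed

lemma block_matrix_mult_block_vector:
  "block_matrix P Q R S *v block_vector u v = block_vector (P *v u + Q *v v) (R *v u + S *v v)"
  by (simp add: block_matrix_def block_vector_def matrix_vector_mult_def vec_eq_iff
      sum_UNIV_plus split: sum.split)

lemma transpose_block_matrix:
  "transpose (block_matrix P Q R S) =
    block_matrix (transpose P) (transpose R) (transpose Q) (transpose S)"
  by (simp add: block_matrix_def block_vector_def transpose_def vec_eq_iff split: sum.split)

lemma map_matrix_block_matrix:
  "map_matrix f (block_matrix P Q R S) =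
    block_matrix (map_matrix f P) (map_matrix f Q) (map_matrix f R) (map_matrix f S)"
  by (simp add: block_matrix_def block_vector_def map_matrix_def vec_eq_iff split: sum.split)

lemma map_matrix_transpose: "map_matrix f (transpose M) = transpose (map_matrix f M)"
  by (simp add: map_matrix_def transpose_def vec_eq_iff)

lemma transpose_diff: "transpose (M - N) = transpose M - transpose N"
  by (simp add: transpose_def vec_eq_iff)

text \<open>A matrix and its transpose have the same determinant.\<close>

lemma exists_kernel_transpose:
  fixes M :: "'a::field ^ 'n ^ 'n"
  assumes "M *v w = 0" and "w \<noteq> 0"
  obtains w' where "transpose M *v w' = 0" and "w' \<noteq> 0"
proof -
  have "\<not> invertible M"
    using assms by (auto simp: invertible_left_inverse matrix_left_invertible_ker)
  then have "\<not> invertible (transpose M)"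
    by (metis invertible_det_nz det_transpose)
  then show thesis
    using that by (auto simp: invertible_left_inverse matrix_left_invertible_ker)
qed

lemma positive_definite_invertible:
  assumes "positive_definite_matrix R"
  shows "invertible R"
proof -
  have "v = 0" if "R *v v = 0" for v
    using assms that unfolding positive_definite_matrix_def by force
  then show ?thesis
    by (simp add: invertible_left_inverse matrix_left_invertible_ker)
qed

lemma symmetric_matrix_inv:
  fixes R :: "'a::field ^ 'n ^ 'n"
  assumes "invertible R" and "symmetric_matrix R"
  shows "symmetric_matrix (matrix_inv R)"
proof -
  have inv: "R ** matrix_inv R = mat 1"
    using assms(1) unfolding invertible_def matrix_inv_def by (rule someI_ex[THEN conjunct1])
  have "transpose (matrix_inv R) ** R = transpose (R ** matrix_inv R)"
    using assms(2) by (simp add: matrix_transpose_mul symmetric_matrix_def)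
  then have "transpose (matrix_inv R) ** R = mat 1"
    by (simp add: inv)
  then have "transpose (matrix_inv R) = matrix_inv R"
    by (metis inv matrix_mul_assoc matrix_mul_lid matrix_mul_rid)
  then show ?thesis by (simp add: symmetric_matrix_def)
qed

lemma symmetric_matrix_congruence:
  fixes N :: "'a::comm_semiring_1 ^ 'm ^ 'm" and B :: "'a ^ 'm ^ 'n"
  assumes "symmetric_matrix N"
  shows "symmetric_matrix (B ** N ** transpose B)"
  using assms by (simp add: symmetric_matrix_def matrix_transpose_mul matrix_mul_assoc)

lemma bidir_eigenvalue_block_iff:
  fixes P Q R S :: "real ^ 'n ^ 'n"
  shows "bidir_eigenvalue (block_matrix P Q R S) \<mu> \<longleftrightarrow>
    (\<exists>x l. (x, l) \<noteq> (0, 0) \<and>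
      map_matrix complex_of_real P *v x + \<mu> *s (map_matrix complex_of_real Q *v l) = \<mu> *s x \<and>
      map_matrix complex_of_real R *v x + \<mu> *s (map_matrix complex_of_real S *v l) = l)"
  by (simp add: bidir_eigenvalue_def map_matrix_block_matrix block_matrix_mult_block_vector
      block_vector_eq_iff vector_scalar_commute)

text \<open>The symmetry under time reversal comes from the block structure: the off-diagonal blocks are
  symmetric and the diagonal blocks are transposes of each other, so that transposing the pencil
  again gives the eigenvector equations, with the two unknowns swapped and \<open>\<mu>\<close> inverted.  Here \<open>G\<close>
  is the whole upper right block, including its sign.\<close>

lemma bidir_eigenvalue_inverse:
  fixes A G Q :: "real ^ 'n ^ 'n" and \<mu> :: complex
  assumes G: "symmetric_matrix G" and Q: "symmetric_matrix Q" and \<mu>: "\<mu> \<noteq> 0"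
    and ev: "bidir_eigenvalue (block_matrix A G Q (transpose A)) \<mu>"
  shows "bidir_eigenvalue (block_matrix A G Q (transpose A)) (1 / \<mu>)"
proof -
  note [simp del] = transpose_matrix_vector
  let ?c = "map_matrix complex_of_real"
  have trG: "transpose (?c G) = ?c G" and trQ: "transpose (?c Q) = ?c Q"
    using G Q by (simp_all add: symmetric_matrix_def flip: map_matrix_transpose)
  \<comment> \<open>All terms of the eigenvector equations are moved to one side; the scalar matrices \<open>mat \<mu>\<close>
    stand for multiplication by \<open>\<mu>\<close> so that the transpose of the pencil can be computed blockwise.\<close>
  define M where "M = block_matrix (?c A - mat \<mu>) (mat \<mu> ** ?c G)
    (?c Q) (mat \<mu> ** transpose (?c A) - mat 1)"
  have mat_mult: "mat a *v v = a *s v" for a :: complex and v :: "complex ^ 'n"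
    by (simp add: matrix_vector_mult_def mat_def vec_eq_iff if_distrib if_distribR cong: if_cong)
  have M_mult: "M *v block_vector x l =
      block_vector (?c A *v x + \<mu> *s (?c G *v l) - \<mu> *s x)
        (?c Q *v x + \<mu> *s (transpose (?c A) *v l) - l)" for x l
    by (simp add: M_def block_matrix_mult_block_vector block_vector_eq_iff mat_mult
        matrix_vector_mult_diff_rdistrib algebra_simps flip: matrix_vector_mul_assoc)
  obtain x l where "(x, l) \<noteq> (0, 0)"
    and "?c A *v x + \<mu> *s (?c G *v l) = \<mu> *s x"
    and "?c Q *v x + \<mu> *s (transpose (?c A) *v l) = l"
    using ev by (auto simp: bidir_eigenvalue_block_iff map_matrix_transpose)
  then have "M *v block_vector x l = 0" and "block_vector x l \<noteq> 0"
    by (auto simp: M_mult block_vector_eq_iff simp flip: block_vector_0)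
  then obtain w where "transpose M *v w = 0" and "w \<noteq> 0"
    by (rule exists_kernel_transpose)
  moreover obtain u v where "w = block_vector u v"
    by (rule block_vector_surj)
  ultimately have uv: "transpose M *v block_vector u v = 0" and nz: "(u, v) \<noteq> (0, 0)"
    by (auto simp: block_vector_0)
  have "transpose M *v block_vector u v =
      block_vector (transpose (?c A) *v u - \<mu> *s u + ?c Q *v v)
        (\<mu> *s (?c G *v u) + \<mu> *s (?c A *v v) - v)"
    by (simp add: M_def transpose_block_matrix block_matrix_mult_block_vector block_vector_eq_iff
        transpose_diff matrix_transpose_mul trG trQ mat_mult matrix_vector_mult_diff_rdistrib
        vector_scalar_commute flip: matrix_vector_mul_assoc)
  with uv have u: "transpose (?c A) *v u - \<mu> *s u + ?c Q *v v = 0"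
    and v: "\<mu> *s (?c G *v u) + \<mu> *s (?c A *v v) - v = 0"
    by (simp_all add: block_vector_eq_iff flip: block_vector_0)
  \<comment> \<open>The new state is \<open>v\<close> and the new costate \<open>\<mu> *s u\<close>: the factor \<open>1 / \<mu>\<close> that the eigenvector
    equations put in front of the costate then cancels.\<close>
  have "?c A *v v + ?c G *v u = (1 / \<mu>) *s (\<mu> *s (?c G *v u) + \<mu> *s (?c A *v v))"
    using \<mu> by (simp add: vector_add_ldistrib vector_smult_assoc add.commute)
  also have "\<dots> = (1 / \<mu>) *s v"
    using v by simp
  finally have "?c A *v v + (1 / \<mu>) *s (?c G *v (\<mu> *s u)) = (1 / \<mu>) *s v"
    using \<mu> by (simp add: vector_scalar_commute vector_smult_assoc)
  moreover have "?c Q *v v + (1 / \<mu>) *s (transpose (?c A) *v (\<mu> *s u)) = \<mu> *s u"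
    using \<mu> u by (simp add: vector_scalar_commute vector_smult_assoc algebra_simps)
  moreover have "(v, \<mu> *s u) \<noteq> (0, 0)"
    using nz \<mu> by (auto simp: vector_mul_eq_0)
  ultimately show ?thesis
    unfolding bidir_eigenvalue_block_iff map_matrix_transpose by blast
qed

theorem theorem5p2:
  fixes A :: "real ^ 'n ^ 'n" and B :: "real ^ 'm ^ 'n"
    and Q :: "real ^ 'n ^ 'n" and R :: "real ^ 'm ^ 'm"
    and \<mu> :: complex
  assumes "symmetric_matrix Q"
    and "symmetric_matrix R" and "positive_definite_matrix R"
    and "\<mu> \<noteq> 0"
    and "bidir_eigenvalue (bidir_matrix A B Q R) \<mu>"
  shows "bidir_eigenvalue (bidir_matrix A B Q R) (1 / \<mu>)"
proof -
  have "symmetric_matrix (B ** matrix_inv R ** transpose B)"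
    using assms(2,3)
    by (intro symmetric_matrix_congruence symmetric_matrix_inv positive_definite_invertible)
  then have "symmetric_matrix (- (B ** matrix_inv R ** transpose B))"
    by (simp add: symmetric_matrix_def transpose_def vec_eq_iff)
  then show ?thesis
    using assms(1,4,5) unfolding bidir_matrix_def by (intro bidir_eigenvalue_inverse)
qed

end
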